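(* Let $\mathcal{Z}\subset\mathbb{R}^{d}$ be non-empty and compact, let $\mathcal{F}\subset\mathbb{R}^{d}$ be non-empty, convex and compact, and let $\ell(z,f)=z^{\mathsf T}f$. Suppose that $\mathcal{F}$ is a polyhedron. Then either the game $(\ell,\mathcal{Z},\mathcal{F})$ is trivial, or $R_T(\ell,\mathcal{Z},\mathcal{F})=\Omega(\sqrt{T})$, i.e. there exist $c>0$ and $T_0$ such that $R_T(\ell,\mathcal{Z},\mathcal{F})\ge c\sqrt{T}$ for all integers $T\ge T_0$.
   Context: Value of the game: for an integer $T\ge1$, $$R_T(\ell,\mathcal{Z},\mathcal{F})=\inf_{f_1\in\mathcal{F}}\sup_{z_1\in\mathcal{Z}}\cdots\inf_{f_T\in\mathcal{F}}\sup_{z_T\in\mathcal{Z}}\Big[\sum_{t=1}^T\ell(z_t,f_t)-\inf_{f\in\mathcal{F}}\sum_{t=1}^T\ell(z_t,f)\Big].$$ Trivial game: $(\ell,\mathcal{Z},\mathcal{F})$ is trivial if there exists $f^*\in\mathcal{F}$ such that $\ell(z,f^* )\le\min_{f\in\mathcal{F}}\ell(z,f)$ for all $z\in\mathcal{Z}$. *)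

theory Defs
  imports "HOL-Analysis.Analysis"
begin

text \<open>Infima and suprema are taken in the extended reals, so that they have their usual
  meaning for arbitrary (possibly unbounded) losses. The history \<open>h\<close> lists the pairs
  \<open>(z\<^sub>t, f\<^sub>t)\<close> played so far, and the first \<open>nat\<close> argument of \<open>value_from\<close> is the
  number of rounds still to be played.\<close>

definition regret :: "('z \<Rightarrow> 'f \<Rightarrow> real) \<Rightarrow> 'f set \<Rightarrow> ('z \<times> 'f) list \<Rightarrow> ereal" where
  "regret l F h =
     ereal (\<Sum>(z, g)\<leftarrow>h. l z g) - (INF f\<in>F. ereal (\<Sum>(z, g)\<leftarrow>h. l z f))"

primrec value_from ::
  "('z \<Rightarrow> 'f \<Rightarrow> real) \<Rightarrow> 'z set \<Rightarrow> 'f set \<Rightarrow> nat \<Rightarrow> ('z \<times> 'f) list \<Rightarrow> ereal" where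
  "value_from l Z F 0 h = regret l F h"
| "value_from l Z F (Suc n) h = (INF f\<in>F. SUP z\<in>Z. value_from l Z F n (h @ [(z, f)]))"

definition game_value :: "('z \<Rightarrow> 'f \<Rightarrow> real) \<Rightarrow> 'z set \<Rightarrow> 'f set \<Rightarrow> nat \<Rightarrow> ereal" where
  "game_value l Z F T = value_from l Z F T []"

definition trivial_game :: "('z \<Rightarrow> 'f \<Rightarrow> real) \<Rightarrow> 'z set \<Rightarrow> 'f set \<Rightarrow> bool" where
  "trivial_game l Z F \<longleftrightarrow> (\<exists>f'\<in>F. \<forall>z\<in>Z. \<forall>f\<in>F. l z f' \<le> l z f)"

end

theory Submission
  imports Defs
begin

text \<open>If the game is not trivial, a connectedness argument on the relative interior of the convex
  hull of \<open>Z\<close> gives a point \<open>m\<close> there at which two vertices \<open>v\<close>, \<open>v'\<close> of \<open>F\<close> are both optimal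
  although \<open>z \<bullet> v \<noteq> z \<bullet> v'\<close> for some \<open>z \<in> Z\<close>. An adversary drawing independent moves from a finitely
  supported distribution on \<open>Z\<close> with mean \<open>m\<close> makes every play of the learner lose at least as much
  on average as \<open>v\<close> and \<open>v'\<close>, while the better of \<open>v\<close>, \<open>v'\<close> in hindsight gains half the absolute
  value of a centred random walk over their average. That gain is of order \<open>sqrt T\<close> by a
  second and fourth moment computation. Expectations enter the value of the game by backward
  induction, since the supremum over the adversary's moves is at least their average.\<close>

section \<open>Centred random walks\<close>

locale centred_walk =
  fixes A :: "'a set" and p X :: "'a \<Rightarrow> real"
  assumes finite_support: "finite A"
    and weight_nonneg: "\<And>a. a \<in> A \<Longrightarrow> 0 \<le> p a"
    and weight_sum: "(\<Sum>a\<in>A. p a) = 1"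
    and centred: "(\<Sum>a\<in>A. p a * X a) = 0"
begin

text \<open>The transition operator of the walk: \<open>(step ^^ n) g s\<close> is the expectation
  of \<open>g\<close> after \<open>n\<close> independent increments starting from \<open>s\<close>.
  This form unrolls one round at a time, as \<open>value_from\<close> does.\<close>

definition step :: "(real \<Rightarrow> real) \<Rightarrow> real \<Rightarrow> real" where
  "step g s = (\<Sum>a\<in>A. p a * g (s + X a))"

definition variance :: real where
  "variance = (\<Sum>a\<in>A. p a * (X a)\<^sup>2)"

text \<open>A weighted mean never exceeds the maximum. This replaces the random draw by an actual
  move of the adversary.\<close>

lemma average_le_some: "\<exists>a\<in>A. (\<Sum>b\<in>A. p b * g b) \<le> g a" for g :: "'a \<Rightarrow> real"
proof -
  have ne: "A \<noteq> {}"
    using weight_sum by auto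
  have "(\<Sum>b\<in>A. p b * g b) \<le> (\<Sum>b\<in>A. p b * Max (g ` A))"
    by (intro sum_mono mult_left_mono weight_nonneg Max_ge) (auto simp: finite_support)
  also have "\<dots> = Max (g ` A)"
    by (simp add: weight_sum flip: sum_distrib_right)
  finally have "(\<Sum>b\<in>A. p b * g b) \<le> Max (g ` A)" .
  moreover have "Max (g ` A) \<in> g ` A"
    using ne finite_support by (intro Max_in) auto
  ultimately show ?thesis
    by auto
qed

lemma step_mono: "(\<And>s. g s \<le> h s) \<Longrightarrow> step g s \<le> step h s"
  unfolding step_def by (intro sum_mono mult_left_mono weight_nonneg)

lemma steps_mono: "(\<And>s. g s \<le> h s) \<Longrightarrow> (step ^^ n) g s \<le> (step ^^ n) h s"
  by (induction n arbitrary: s) (auto intro: step_mono)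

lemma step_linear: "step (\<lambda>s. a * g s + b * h s) s = a * step g s + b * step h s"
  by (simp add: step_def sum_distrib_left sum.distrib algebra_simps)

lemma steps_linear:
  "(step ^^ n) (\<lambda>s. a * g s + b * h s) = (\<lambda>s. a * (step ^^ n) g s + b * (step ^^ n) h s)"
  by (induction n) (auto simp: step_linear)

lemma step_const: "step (\<lambda>_. c) s = c"
  by (simp add: step_def weight_sum flip: sum_distrib_right)

section \<open>Second and fourth moments of the walk\<close>

lemma step_square: "step (\<lambda>s. s\<^sup>2) s = s\<^sup>2 + variance"
proof -
  have "step (\<lambda>s. s\<^sup>2) s = (\<Sum>a\<in>A. s\<^sup>2 * p a + (2 * s * (p a * X a) + p a * (X a)\<^sup>2))"
    unfolding step_def by (intro sum.cong) (auto simp: power2_eq_square algebra_simps)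
  also have "\<dots> = s\<^sup>2 + variance"
    by (simp add: sum.distrib weight_sum centred variance_def flip: sum_distrib_left)
  finally show ?thesis .
qed

lemma steps_square: "(step ^^ n) (\<lambda>s. s\<^sup>2) = (\<lambda>s. s\<^sup>2 + real n * variance)"
proof (induction n)
  case (Suc n)
  show ?case
  proof
    fix s
    have "(step ^^ Suc n) (\<lambda>s. s\<^sup>2) s = step (\<lambda>s. 1 * s\<^sup>2 + real n * variance) s"
      using Suc by simp
    also have "\<dots> = s\<^sup>2 + real (Suc n) * variance"
      using step_linear[of 1 "\<lambda>s. s\<^sup>2" 1 "\<lambda>_. real n * variance" s]
      by (simp add: step_square step_const algebra_simps)
    finally show "(step ^^ Suc n) (\<lambda>s. s\<^sup>2) s = s\<^sup>2 + real (Suc n) * variance" .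
  qed
qed simp

lemma variance_le:
  assumes "\<And>a. a \<in> A \<Longrightarrow> \<bar>X a\<bar> \<le> B"
  shows "variance \<le> B\<^sup>2"
proof -
  have "(X a)\<^sup>2 \<le> B\<^sup>2" if "a \<in> A" for a
    using assms[OF that] by (metis abs_ge_zero power2_abs power_mono)
  then have "variance \<le> (\<Sum>a\<in>A. p a * B\<^sup>2)"
    unfolding variance_def by (intro sum_mono mult_left_mono weight_nonneg)
  then show ?thesis
    by (simp add: weight_sum flip: sum_distrib_right)
qed

text \<open>In the expansion of \<open>(s + x)^4\<close> the term linear in \<open>x\<close>
  averages out, and \<open>4 * s * x^3\<close> is absorbed into the even terms since
  \<open>2 * s * x\<close> is at most \<open>s^2 + x^2\<close>. This gives the coefficients 6 + 2
  and 1 + 2.\<close>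

lemma step_fourth_power_le:
  assumes B: "\<And>a. a \<in> A \<Longrightarrow> \<bar>X a\<bar> \<le> B"
  shows "step (\<lambda>s. s^4) s \<le> s^4 + 8 * B\<^sup>2 * s\<^sup>2 + 3 * B^4"
proof -
  have pt: "(s + x)^4 \<le> s^4 + 8 * B\<^sup>2 * s\<^sup>2 + 3 * B^4 + 4 * s^3 * x"
    if "\<bar>x\<bar> \<le> B" for x
  proof -
    have x2: "x\<^sup>2 \<le> B\<^sup>2"
      using that by (metis abs_ge_zero power2_abs power_mono)
    have "(s + x)^4 = s^4 + 4 * s^3 * x + 6 * (s\<^sup>2 * x\<^sup>2) + 4 * s * x * x\<^sup>2 + x\<^sup>2 * x\<^sup>2"
      by (simp add: power2_eq_square power3_eq_cube power4_eq_xxxx algebra_simps)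
    moreover have "4 * s * x * x\<^sup>2 \<le> (2 * s\<^sup>2 + 2 * x\<^sup>2) * x\<^sup>2"
    proof (rule mult_right_mono)
      show "4 * s * x \<le> 2 * s\<^sup>2 + 2 * x\<^sup>2"
        using zero_le_power2[of "s - x"] by (simp add: power2_diff)
    qed simp
    moreover have "s\<^sup>2 * x\<^sup>2 \<le> s\<^sup>2 * B\<^sup>2" "x\<^sup>2 * x\<^sup>2 \<le> B\<^sup>2 * B\<^sup>2"
      by (intro mult_mono x2 order_refl zero_le_power2)+
    moreover have "B\<^sup>2 * B\<^sup>2 = B^4"
      by (simp add: power2_eq_square power4_eq_xxxx)
    ultimately show ?thesis
      by (simp add: algebra_simps)
  qed
  have "step (\<lambda>s. s^4) s
      \<le> (\<Sum>a\<in>A. p a * (s^4 + 8 * B\<^sup>2 * s\<^sup>2 + 3 * B^4 + 4 * s^3 * X a))"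
    unfolding step_def by (intro sum_mono mult_left_mono weight_nonneg pt B)
  also have "\<dots> = (\<Sum>a\<in>A. (s^4 + 8 * B\<^sup>2 * s\<^sup>2 + 3 * B^4) * p a + 4 * s^3 * (p a * X a))"
    by (intro sum.cong) (auto simp: algebra_simps)
  also have "\<dots> = s^4 + 8 * B\<^sup>2 * s\<^sup>2 + 3 * B^4"
    by (simp add: sum.distrib weight_sum centred flip: sum_distrib_left)
  finally show ?thesis .
qed

text \<open>By induction: passing from \<open>n\<close> to \<open>n + 1\<close> adds at most
  \<open>(8 * n + 3) * B^4\<close> to the constant term, which the growth of
  \<open>3 * n + 4 * n^2\<close> covers. From \<open>s = 0\<close> the fourth moment is thus of
  order \<open>n^2\<close>.\<close>

lemma steps_fourth_power_le:
  assumes B: "\<And>a. a \<in> A \<Longrightarrow> \<bar>X a\<bar> \<le> B"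
  shows "(step ^^ n) (\<lambda>s. s^4) s
    \<le> s^4 + 8 * B\<^sup>2 * real n * s\<^sup>2 + (3 * real n + 4 * (real n)\<^sup>2) * B^4"
proof (induction n arbitrary: s)
  case (Suc n)
  let ?c = "8 * B\<^sup>2 * real n" and ?d = "(3 * real n + 4 * (real n)\<^sup>2) * B^4"
  have "(step ^^ Suc n) (\<lambda>s. s^4) s \<le> step (\<lambda>s. 1 * (1 * s^4 + ?c * s\<^sup>2) + 1 * ?d) s"
    using step_mono[OF Suc] by simp
  also have "\<dots> = step (\<lambda>s. s^4) s + ?c * (s\<^sup>2 + variance) + ?d"
    unfolding step_linear step_square step_const by simp
  also have "\<dots> \<le> (s^4 + 8 * B\<^sup>2 * s\<^sup>2 + 3 * B^4) + ?c * (s\<^sup>2 + B\<^sup>2) + ?d"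
    by (intro add_mono mult_left_mono step_fourth_power_le variance_le B order_refl) auto
  also have "\<dots> \<le> s^4 + 8 * B\<^sup>2 * real (Suc n) * s\<^sup>2
      + (3 * real (Suc n) + 4 * (real (Suc n))\<^sup>2) * B^4"
    using zero_le_power2[of "B\<^sup>2"]
    by (simp add: power2_eq_square power4_eq_xxxx algebra_simps)
  finally show ?case .
qed simp

text \<open>The absolute value dominates \<open>s^2 / t - s^4 / t^3\<close> pointwise. With
  \<open>t\<close> of order \<open>sqrt n\<close>, both moments contribute at order
  \<open>sqrt n\<close>, and the second moment wins once \<open>t\<close> is a large enough multiple
  of \<open>sqrt n\<close>.\<close>

lemma steps_abs_ge:
  assumes pos: "0 < variance"
  obtains c where "0 < c" "\<And>n. c * sqrt (real n) \<le> (step ^^ n) (\<lambda>s. \<bar>s\<bar>) 0"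
proof -
  define B where "B = Max ((\<lambda>a. \<bar>X a\<bar>) ` A)"
  have B: "\<bar>X a\<bar> \<le> B" if "a \<in> A" for a
    unfolding B_def using that finite_support by auto
  have "B \<noteq> 0"
    using variance_le[OF B] pos by auto
  \<comment> \<open>chosen to make the fourth moment term half of the second moment term\<close>
  define k where "k = sqrt (14 * B^4 / variance)"
  have k2: "k\<^sup>2 = 14 * B^4 / variance" and k: "k > 0"
    unfolding k_def using pos \<open>B \<noteq> 0\<close> by auto
  have "variance / (2 * k) * sqrt (real n) \<le> (step ^^ n) (\<lambda>s. \<bar>s\<bar>) 0" for n
  proof (cases "n = 0")
    case False
    then have n: "real n \<ge> 1"
      by simp
    define t where "t = k * sqrt (real n)"
    have t: "t > 0" and t2: "t\<^sup>2 = 14 * B^4 / variance * real n"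
      unfolding t_def using k n by (auto simp: power_mult_distrib k2)
    \<comment> \<open>Rescaling by \<open>t\<close> reduces the claim to
      \<open>u^2 - u^4 \<le> u\<close> for nonnegative \<open>u\<close>.\<close>
    have pt: "1 / t * s\<^sup>2 + (- (1 / t^3)) * s^4 \<le> \<bar>s\<bar>" for s
    proof -
      define u where "u = \<bar>s\<bar> / t"
      have u: "u \<ge> 0" "\<bar>s\<bar> = t * u"
        unfolding u_def using t by auto
      have "0 \<le> 1 - u + u^3"
      proof (cases "u \<le> 1")
        case False
        then show ?thesis
          using power_increasing[of 1 3 u] by simp
      qed (use u in auto)
      then have "0 \<le> t * u * (1 - u + u^3)"
        using u t by simp
      then have "t * u\<^sup>2 - t * u^4 \<le> t * u"
        by (simp add: algebra_simps power2_eq_square power3_eq_cube power4_eq_xxxx)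
      moreover have "s\<^sup>2 = (t * u)\<^sup>2" "s^4 = (t * u)^4"
        using u by (metis power2_abs, metis power_even_abs_numeral even_numeral)
      then have "1 / t * s\<^sup>2 = t * u\<^sup>2" "1 / t^3 * s^4 = t * u^4"
        using t by (simp_all add: power2_eq_square power3_eq_cube power4_eq_xxxx)
      ultimately show ?thesis
        using u by simp
    qed
    have "(step ^^ n) (\<lambda>s. s^4) 0 \<le> (3 * real n + 4 * (real n)\<^sup>2) * B^4"
      using steps_fourth_power_le[OF B, of n 0] by simp
    also have "\<dots> \<le> (7 * (real n)\<^sup>2) * B^4"
      using n by (intro mult_right_mono) (auto simp: power2_eq_square)
    finally have four: "(step ^^ n) (\<lambda>s. s^4) 0 \<le> 7 * (real n)\<^sup>2 * B^4" .
    have eq: "7 * (real n)\<^sup>2 * B^4 = t\<^sup>2 * (real n * variance / 2)"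
      unfolding t2 using pos by (simp add: field_simps power2_eq_square)
    have "1 / t^3 * (7 * (real n)\<^sup>2 * B^4) = real n * variance / (2 * t)"
      unfolding eq using t by (simp add: power2_eq_square power3_eq_cube)
    then have "variance * real n / (2 * t) = 1 / t * (real n * variance)
        - 1 / t^3 * (7 * (real n)\<^sup>2 * B^4)"
      using t by (simp add: field_simps)
    also have "\<dots> \<le> 1 / t * (real n * variance) - 1 / t^3 * (step ^^ n) (\<lambda>s. s^4) 0"
      using t four by (intro diff_left_mono mult_left_mono) auto
    also have "\<dots> = (step ^^ n) (\<lambda>s. 1 / t * s\<^sup>2 + (- (1 / t^3)) * s^4) 0"
      unfolding steps_linear steps_square by simp
    also have "\<dots> \<le> (step ^^ n) (\<lambda>s. \<bar>s\<bar>) 0"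
      by (intro steps_mono pt)
    finally have "variance * real n / (2 * t) \<le> (step ^^ n) (\<lambda>s. \<bar>s\<bar>) 0" .
    moreover have "variance * real n / (2 * t) = variance / (2 * k) * (real n / sqrt (real n))"
      unfolding t_def by simp
    ultimately show ?thesis
      by (simp add: real_div_sqrt)
  qed simp
  moreover have "0 < variance / (2 * k)"
    using pos k by simp
  ultimately show thesis
    by (rule that[rotated])
qed

end

section \<open>The adversary playing at random\<close>

text \<open>The infimum over \<open>F\<close> is at most the smaller of the losses of
  \<open>v\<close> and \<open>v'\<close>, and \<open>min a b\<close> equals
  \<open>(a + b) / 2 - \<bar>a - b\<bar> / 2\<close>.\<close>

lemma regret_ge:
  assumes "v \<in> F" "v' \<in> F"
  shows "ereal ((\<Sum>(z, g)\<leftarrow>h. z \<bullet> (g - (1/2) *\<^sub>R (v + v'))) + 1/2 * \<bar>\<Sum>(z, g)\<leftarrow>h. z \<bullet> (v - v')\<bar>)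
    \<le> regret (\<lambda>z f. z \<bullet> f) F h"
proof -
  have mean: "(\<Sum>(z, g)\<leftarrow>h. z \<bullet> (g - (1/2) *\<^sub>R (v + v')))
      = (\<Sum>(z, g)\<leftarrow>h. z \<bullet> g) - 1/2 * (\<Sum>(z, g)\<leftarrow>h. z \<bullet> v) - 1/2 * (\<Sum>(z, g)\<leftarrow>h. z \<bullet> v')"
    by (induction h) (auto simp: inner_simps algebra_simps)
  have diff: "(\<Sum>(z, g)\<leftarrow>h. z \<bullet> (v - v')) = (\<Sum>(z, g)\<leftarrow>h. z \<bullet> v) - (\<Sum>(z, g)\<leftarrow>h. z \<bullet> v')"
    by (induction h) (auto simp: inner_simps)
  have ge: "ereal ((\<Sum>(z, g)\<leftarrow>h. z \<bullet> g) - (\<Sum>(z, g)\<leftarrow>h. z \<bullet> u)) \<le> regret (\<lambda>z f. z \<bullet> f) F h"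
    if "u \<in> F" for u
    unfolding regret_def ereal_minus(1)[symmetric] using that
    by (intro ereal_minus_mono order_refl INF_lower)
  show ?thesis
    using ge[OF assms(1)] ge[OF assms(2)] unfolding mean diff
    by (cases "regret (\<lambda>z f. z \<bullet> f) F h") (auto simp: field_simps abs_if)
qed

text \<open>The left side is a potential: the learner's excess loss so far over the midpoint of
  \<open>v\<close> and \<open>v'\<close>, plus half the expected distance from 0 of the walk after
  the remaining \<open>n\<close> rounds. Averaged over a move it does not drop, because the midpoint
  is optimal against the mean move.\<close>

lemma value_from_ge:
  fixes A Z F :: "'a::real_inner set"
  assumes walk: "centred_walk A p (\<lambda>z. z \<bullet> (v - v'))"
    and "A \<subseteq> Z" and v: "v \<in> F" "v' \<in> F"
    and opt: "\<And>f. f \<in> F \<Longrightarrow> (\<Sum>z\<in>A. p z *\<^sub>R z) \<bullet> v \<le> (\<Sum>z\<in>A. p z *\<^sub>R z) \<bullet> f"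
  shows "ereal ((\<Sum>(z, g)\<leftarrow>h. z \<bullet> (g - (1/2) *\<^sub>R (v + v')))
      + 1/2 * (centred_walk.step A p (\<lambda>z. z \<bullet> (v - v')) ^^ n) (\<lambda>s. \<bar>s\<bar>) (\<Sum>(z, g)\<leftarrow>h. z \<bullet> (v - v')))
    \<le> value_from (\<lambda>z f. z \<bullet> f) Z F n h"
proof (induction n arbitrary: h)
  case 0
  then show ?case
    using regret_ge[OF v, of h] by simp
next
  case (Suc n)
  interpret centred_walk A p "\<lambda>z. z \<bullet> (v - v')"
    by (rule walk)
  let ?S = "\<Sum>(z, g)\<leftarrow>h. z \<bullet> (v - v')" and ?L = "\<Sum>(z, g)\<leftarrow>h. z \<bullet> (g - (1/2) *\<^sub>R (v + v'))"
  let ?G = "(step ^^ n) (\<lambda>s. \<bar>s\<bar>)" and ?m = "\<Sum>z\<in>A. p z *\<^sub>R z"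
  have m_inner: "(\<Sum>z\<in>A. p z * (z \<bullet> y)) = ?m \<bullet> y" for y
    by (simp add: inner_sum_left)
  have eq: "?m \<bullet> v' = ?m \<bullet> v"
    using centred unfolding m_inner by (simp add: inner_simps)
  have "ereal (?L + 1/2 * step ?G ?S) \<le> (SUP z\<in>Z. value_from (\<lambda>z f. z \<bullet> f) Z F n (h @ [(z, f)]))"
    if f: "f \<in> F" for f
  proof -
    \<comment> \<open>The potential once \<open>(z, f)\<close> has been appended to
      \<open>h\<close>, with \<open>n\<close> rounds left.\<close>
    let ?\<psi> = "\<lambda>z. ?L + z \<bullet> (f - (1/2) *\<^sub>R (v + v')) + 1/2 * ?G (?S + z \<bullet> (v - v'))"
    have "(\<Sum>z\<in>A. p z * ?\<psi> z) = (\<Sum>z\<in>A. ?L * p z) + (\<Sum>z\<in>A. p z * (z \<bullet> (f - (1/2) *\<^sub>R (v + v'))))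
        + (\<Sum>z\<in>A. 1/2 * (p z * ?G (?S + z \<bullet> (v - v'))))"
      unfolding sum.distrib[symmetric] by (intro sum.cong) (auto simp: algebra_simps)
    also have "\<dots> = ?L + ?m \<bullet> (f - (1/2) *\<^sub>R (v + v')) + 1/2 * step ?G ?S"
      unfolding m_inner sum_distrib_left[symmetric] step_def weight_sum by simp
    finally have "(\<Sum>z\<in>A. p z * ?\<psi> z) = \<dots>" .
    moreover have "0 \<le> ?m \<bullet> (f - (1/2) *\<^sub>R (v + v'))"
      using opt[OF f] eq by (simp add: inner_diff_right inner_add_right)
    moreover obtain z where z: "z \<in> A" "(\<Sum>z\<in>A. p z * ?\<psi> z) \<le> ?\<psi> z"
      using average_le_some[of ?\<psi>] by blast
    ultimately have "ereal (?L + 1/2 * step ?G ?S) \<le> ereal (?\<psi> z)"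
      by simp
    also have "\<dots> \<le> value_from (\<lambda>z f. z \<bullet> f) Z F n (h @ [(z, f)])"
      using Suc[of "h @ [(z, f)]"] by simp
    also have "\<dots> \<le> (SUP z\<in>Z. value_from (\<lambda>z f. z \<bullet> f) Z F n (h @ [(z, f)]))"
      using z \<open>A \<subseteq> Z\<close> by (intro SUP_upper) auto
    finally show ?thesis .
  qed
  then show ?case
    by (auto intro: INF_greatest)
qed

section \<open>Geometry of nontrivial games\<close>

lemma linear_min_convex_hull:
  fixes m :: "'a::real_inner"
  assumes "\<And>u. u \<in> V \<Longrightarrow> c \<le> m \<bullet> u" "f \<in> convex hull V"
  shows "c \<le> m \<bullet> f"
  using hull_minimal[of V "{x. m \<bullet> x \<ge> c}" convex] assms convex_halfspace_ge[of c m] by auto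

text \<open>Without such a tie, the optimality cells of vertices that differ on \<open>Z\<close>
  would be disjoint on the relative interior. Being closed and finite in number, they cannot split
  this connected set, so a single vertex would be optimal against all of \<open>Z\<close>.\<close>

lemma nontrivial_game_tie:
  fixes Z V :: "'a::euclidean_space set"
  assumes "Z \<noteq> {}" and V: "finite V" "V \<noteq> {}"
    and nontrivial: "\<not> trivial_game (\<lambda>z f. z \<bullet> f) Z (convex hull V)"
  obtains m v v' z where "m \<in> rel_interior (convex hull Z)" "v \<in> V" "v' \<in> V"
    "\<And>u. u \<in> V \<Longrightarrow> m \<bullet> v \<le> m \<bullet> u" "\<And>u. u \<in> V \<Longrightarrow> m \<bullet> v' \<le> m \<bullet> u"
    "z \<in> Z" "z \<bullet> v \<noteq> z \<bullet> v'"
proof (rule ccontr)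
  note found = that
  assume no_tie: "\<not> thesis"
  let ?R = "rel_interior (convex hull Z)"
  define D where "D v = {m. \<forall>u\<in>V. m \<bullet> v \<le> m \<bullet> u}" for v
  have closed_D: "closed (D v)" for v
    unfolding D_def by (simp only: Collect_ball_eq)
      (intro closed_INT ballI closed_Collect_le continuous_intros)
  have tie: "z \<bullet> v = z \<bullet> v'"
    if "m \<in> ?R" "v \<in> V" "v' \<in> V" "m \<in> D v" "m \<in> D v'" "z \<in> Z" for m v v' z
  proof (rule ccontr)
    assume "z \<bullet> v \<noteq> z \<bullet> v'"
    then have thesis
      using that by (intro found[of m v v' z]) (auto simp: D_def)
    then show False
      using no_tie by simp
  qed
  have cover: "\<exists>v\<in>V. m \<in> D v" for m
    using ex_min_if_finite[of "(\<lambda>u. m \<bullet> u) ` V"] V unfolding D_def by (fastforce simp: not_less)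
  obtain m0 where m0: "m0 \<in> ?R"
    using \<open>Z \<noteq> {}\<close> rel_interior_eq_empty[of "convex hull Z"] by auto
  obtain v0 where v0: "v0 \<in> V" "m0 \<in> D v0"
    using cover by blast
  \<comment> \<open>The vertices that no move of the adversary distinguishes from \<open>v0\<close>.
    A point lying in a cell from \<open>E\<close> and in one from \<open>V - E\<close> would be a
    tie.\<close>
  define E where "E = {v \<in> V. \<forall>z\<in>Z. z \<bullet> v = z \<bullet> v0}"
  have "?R \<inter> (\<Union>v\<in>V - E. D v) = {}"
  proof (rule ccontr)
    assume ne: "?R \<inter> (\<Union>v\<in>V - E. D v) \<noteq> {}"
    have closed: "closed (\<Union>v\<in>E. D v)" "closed (\<Union>v\<in>V - E. D v)"
      unfolding E_def using V closed_D by (auto intro!: closed_UN)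
    have "?R \<subseteq> (\<Union>v\<in>E. D v) \<union> (\<Union>v\<in>V - E. D v)"
      using cover by blast
    moreover have "(\<Union>v\<in>E. D v) \<inter> (\<Union>v\<in>V - E. D v) \<inter> ?R = {}"
    proof (rule ccontr)
      assume "(\<Union>v\<in>E. D v) \<inter> (\<Union>v\<in>V - E. D v) \<inter> ?R \<noteq> {}"
      then obtain m v v' where m: "m \<in> ?R" "v \<in> E" "m \<in> D v" "v' \<in> V - E" "m \<in> D v'"
        by blast
      then have "z \<bullet> v' = z \<bullet> v0" if "z \<in> Z" for z
        using tie[of m v v' z] that unfolding E_def by auto
      then show False
        using m unfolding E_def by auto
    qed
    moreover have "(\<Union>v\<in>E. D v) \<inter> ?R \<noteq> {}"
      using m0 v0 unfolding E_def by auto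
    moreover have "connected ?R"
      by (simp add: convex_connected convex_rel_interior)
    ultimately show False
      using closed ne unfolding connected_closed by (metis inf_commute)
  qed
  then have R_E: "?R \<subseteq> (\<Union>v\<in>E. D v)"
    using cover by blast
  have E_eq: "m \<bullet> v = m \<bullet> v0" if "v \<in> E" "m \<in> convex hull Z" for m v
    using hull_minimal[of Z "{x. (v - v0) \<bullet> x = 0}" convex] that convex_hyperplane[of "v - v0" 0]
    unfolding E_def by (auto simp: inner_simps inner_commute)
  have "?R \<subseteq> D v0"
  proof
    fix m assume m: "m \<in> ?R"
    then obtain v where "v \<in> E" "m \<in> D v"
      using R_E by blast
    then show "m \<in> D v0"
      using E_eq[of v m] m rel_interior_subset[of "convex hull Z"] unfolding D_def by auto
  qed
  \<comment> \<open>Moves in \<open>Z\<close> may lie on the relative boundary of the hull;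
    closedness of the cell carries optimality over to them.\<close>
  then have "closure ?R \<subseteq> D v0"
    by (rule closure_minimal[OF _ closed_D])
  moreover have "Z \<subseteq> closure ?R"
    using convex_closure_rel_interior[of "convex hull Z"] hull_subset[of Z convex]
      closure_subset[of "convex hull Z"] by auto
  ultimately have "\<forall>z\<in>Z. \<forall>f\<in>convex hull V. z \<bullet> v0 \<le> z \<bullet> f"
    using linear_min_convex_hull[of V] unfolding D_def by blast
  then show False
    using nontrivial v0 hull_inc[of v0 V convex] unfolding trivial_game_def by blast
qed

text \<open>The segment from \<open>z0\<close> to \<open>m\<close> can be prolonged beyond
  \<open>m\<close> inside the hull, so \<open>m\<close> is a proper mixture of \<open>z0\<close> and
  a hull point. Hence the prescribed point \<open>z0\<close> receives positive weight.\<close>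

lemma rel_interior_convex_hull_weights:
  fixes Z :: "'a::euclidean_space set"
  assumes m: "m \<in> rel_interior (convex hull Z)" and z0: "z0 \<in> Z"
  obtains A p where "finite A" "A \<subseteq> Z" "z0 \<in> A" "\<And>z. z \<in> A \<Longrightarrow> 0 \<le> p z" "0 < p z0"
    "sum p A = 1" "(\<Sum>z\<in>A. p z *\<^sub>R z) = m"
proof -
  have ne: "convex hull Z \<noteq> {}"
    using z0 by auto
  obtain e where e: "e > 1" "(1 - e) *\<^sub>R z0 + e *\<^sub>R m \<in> convex hull Z"
    using m z0 convex_rel_interior_iff[OF convex_convex_hull ne, of m] hull_inc[of z0 Z] by blast
  then obtain S u where S: "finite S" "S \<subseteq> Z" "\<And>z. z \<in> S \<Longrightarrow> 0 \<le> u z" "sum u S = 1"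
    "(\<Sum>z\<in>S. u z *\<^sub>R z) = (1 - e) *\<^sub>R z0 + e *\<^sub>R m"
    unfolding convex_hull_explicit by auto
  define A where "A = insert z0 S"
  define q where "q z = (if z \<in> S then u z else 0)" for z
  \<comment> \<open>Solves \<open>y = (1 - e) *\<^sub>R z0 + e *\<^sub>R m\<close> for
    \<open>m\<close>, with \<open>q\<close> the weights of \<open>y\<close>; the weight left for
    \<open>z0\<close> is \<open>1 - inverse e\<close>.\<close>
  define p where "p z = inverse e * q z + (1 - inverse e) * (if z = z0 then 1 else 0)" for z
  have A: "finite A" "S \<subseteq> A" "z0 \<in> A" "A \<subseteq> Z"
    unfolding A_def using S z0 by auto
  have q: "sum q A = 1" "(\<Sum>z\<in>A. q z *\<^sub>R z) = (1 - e) *\<^sub>R z0 + e *\<^sub>R m"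
  proof -
    have "sum q A = sum u S"
      using A by (intro sum.mono_neutral_cong_right) (auto simp: q_def)
    moreover have "(\<Sum>z\<in>A. q z *\<^sub>R z) = (\<Sum>z\<in>S. u z *\<^sub>R z)"
      using A by (intro sum.mono_neutral_cong_right) (auto simp: q_def)
    ultimately show "sum q A = 1" "(\<Sum>z\<in>A. q z *\<^sub>R z) = (1 - e) *\<^sub>R z0 + e *\<^sub>R m"
      using S by auto
  qed
  have q0: "0 \<le> q z" for z
    unfolding q_def using S by auto
  have e': "inverse e > 0" "inverse e < 1"
    using e by (auto simp: field_simps)
  have delta: "(\<Sum>z\<in>A. (if z = z0 then 1 else 0) *\<^sub>R z) = z0"
  proof -
    have "(\<Sum>z\<in>A. (if z = z0 then 1 else 0) *\<^sub>R z) = (\<Sum>z\<in>A. if z = z0 then z else 0)"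
      by (intro sum.cong) auto
    then show ?thesis
      using A by simp
  qed
  have "sum p A = inverse e * sum q A + (1 - inverse e) * (\<Sum>z\<in>A. if z = z0 then 1 else 0)"
    unfolding p_def sum.distrib sum_distrib_left by simp
  then have "sum p A = 1"
    using A q by simp
  moreover have "(\<Sum>z\<in>A. p z *\<^sub>R z) = inverse e *\<^sub>R (\<Sum>z\<in>A. q z *\<^sub>R z)
      + (1 - inverse e) *\<^sub>R (\<Sum>z\<in>A. (if z = z0 then 1 else 0) *\<^sub>R z)"
    unfolding p_def scaleR_add_left sum.distrib scaleR_sum_right by simp
  then have "(\<Sum>z\<in>A. p z *\<^sub>R z) = m"
    unfolding q delta using e by (simp add: algebra_simps)
  moreover have "0 \<le> p z" "0 < p z0" for z
    unfolding p_def using q0[of z] q0[of z0] e' by (auto intro: add_nonneg_pos)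
  ultimately show thesis
    using A by (intro that[of A p])
qed

section \<open>The lower bound of order \<open>sqrt T\<close>\<close>

lemma nontrivial_game_value_ge:
  fixes Z V :: "'a::euclidean_space set"
  assumes "Z \<noteq> {}" "finite V" "V \<noteq> {}" "\<not> trivial_game (\<lambda>z f. z \<bullet> f) Z (convex hull V)"
  obtains c where "0 < c"
    "\<And>T. ereal (c * sqrt (real T)) \<le> game_value (\<lambda>z f. z \<bullet> f) Z (convex hull V) T"
proof -
  obtain m v v' z0 where m: "m \<in> rel_interior (convex hull Z)" and v: "v \<in> V" "v' \<in> V"
    and opt: "\<And>u. u \<in> V \<Longrightarrow> m \<bullet> v \<le> m \<bullet> u" "\<And>u. u \<in> V \<Longrightarrow> m \<bullet> v' \<le> m \<bullet> u"
    and z0: "z0 \<in> Z" "z0 \<bullet> v \<noteq> z0 \<bullet> v'"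
    by (rule nontrivial_game_tie[OF assms]) blast
  obtain A p where A: "finite A" "A \<subseteq> Z" "z0 \<in> A"
    and p: "\<And>z. z \<in> A \<Longrightarrow> 0 \<le> p z" "0 < p z0" "sum p A = 1"
    and mean: "(\<Sum>z\<in>A. p z *\<^sub>R z) = m"
    by (rule rel_interior_convex_hull_weights[OF m z0(1)]) blast
  have "(\<Sum>z\<in>A. p z * (z \<bullet> (v - v'))) = m \<bullet> (v - v')"
    unfolding mean[symmetric] by (simp add: inner_sum_left)
  also have "\<dots> = 0"
    using opt(1)[OF v(2)] opt(2)[OF v(1)] by (simp add: inner_diff_right)
  finally interpret centred_walk A p "\<lambda>z. z \<bullet> (v - v')"
    using A p by unfold_locales auto
  \<comment> \<open>The move \<open>z0\<close> separates \<open>v\<close> from \<open>v'\<close> and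
    has positive weight, so the walk is not degenerate.\<close>
  have "0 < p z0 * (z0 \<bullet> (v - v'))\<^sup>2"
    using p z0 by (simp add: inner_diff_right)
  also have "\<dots> \<le> variance"
    unfolding variance_def using A p by (intro member_le_sum) auto
  finally obtain c where c: "0 < c" "\<And>n. c * sqrt (real n) \<le> (step ^^ n) (\<lambda>s. \<bar>s\<bar>) 0"
    using steps_abs_ge by blast
  have "ereal (c / 2 * sqrt (real T)) \<le> game_value (\<lambda>z f. z \<bullet> f) Z (convex hull V) T" for T
  proof -
    have "ereal (c / 2 * sqrt (real T)) \<le> ereal (1/2 * (step ^^ T) (\<lambda>s. \<bar>s\<bar>) 0)"
      using c(2)[of T] by simp
    also have "\<dots> \<le> game_value (\<lambda>z f. z \<bullet> f) Z (convex hull V) T"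
      using value_from_ge[OF centred_walk_axioms A(2), of "convex hull V" "[]" T] v mean
        linear_min_convex_hull[of V "m \<bullet> v" m] opt(1)
      by (simp add: game_value_def hull_inc)
    finally show ?thesis .
  qed
  then show thesis
    using c(1) by (intro that[of "c / 2"]) auto
qed

theorem theorem3:
  fixes Z F :: "(real ^ 'd) set"
  assumes "Z \<noteq> {}" and "compact Z"
    and "F \<noteq> {}" and "convex F" and "compact F"
    and "polyhedron F"
  shows "trivial_game (\<lambda>z f. z \<bullet> f) Z F \<or>
    (\<exists>c>0. \<exists>T0. \<forall>T\<ge>T0. game_value (\<lambda>z f. z \<bullet> f) Z F T \<ge> ereal (c * sqrt (real T)))"
proof -
  \<comment> \<open>A bounded polyhedron is the hull of finitely many points, which supplies the
    finite family of cells.\<close>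
  have "polytope F"
    using assms by (simp add: polytope_eq_bounded_polyhedron compact_imp_bounded)
  then obtain V where V: "finite V" "F = convex hull V"
    unfolding polytope_def by blast
  with \<open>F \<noteq> {}\<close> have "V \<noteq> {}"
    by auto
  with V \<open>Z \<noteq> {}\<close> show ?thesis
    by (metis nontrivial_game_value_ge)
qed

end
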